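(* Let $\mathfrak g$ be a root-reductive Lie algebra over $\mathbb K$ with a splitting Borel subalgebra $\mathfrak b$ containing a splitting maximal toral subalgebra $\mathfrak h$. Every object $M\in\bar{\mathcal O}$ is a direct sum of indecomposable objects of $\bar{\mathcal O}$.
   Context: $\mathbb K$ is an algebraically closed field of characteristic $0$; all Lie algebras and vector spaces are over $\mathbb K$. A Lie algebra $\mathfrak g$ is root-reductive if $\mathfrak g=\bigcup_{n\ge1}\mathfrak g_n$ for nested finite-dimensional reductive subalgebras $\mathfrak g_1\subseteq\mathfrak g_2\subseteq\cdots$, with $\mathfrak g_n$ reductive in $\mathfrak g_{n+1}$, such that there are nested subalgebras $\mathfrak k_1\subseteq\mathfrak k_2\subseteq\cdots$ with $\mathfrak k_n$ a Cartan subalgebra of $\mathfrak g_n$ and each inclusion $\mathfrak g_n\hookrightarrow\mathfrak g_{n+1}$ is a root inclusion with respect to $\mathfrak k_{n+1}$, i.e. $\mathfrak g_n\cap\mathfrak k_{n+1}$ is a Cartan subalgebra of $\mathfrak g_n$ and each $(\mathfrak g_n\cap\mathfrak k_{n+1})$-root space of $\mathfrak g_n$ is a root space of $\mathfrak g_{n+1}$. A subalgebra $\mathfrak h$ is a splitting maximal toral subalgebra if $\mathfrak g$ is a directed union of finite-dimensional reductive subalgebras $\mathfrak g_n$ with $\mathfrak h\cap\mathfrak g_n$ maximal toral in $\mathfrak g_n$, and $\mathfrak g=\mathfrak h\oplus\bigoplus_{\alpha\in\Delta}\mathfrak g^\alpha$ is the root space decomposition. A splitting Borel subalgebra is a maximal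 locally solvable subalgebra containing a splitting maximal toral subalgebra. Put $\mathfrak n=[\mathfrak b,\mathfrak b]$. Standing assumption: the exhaustion $(\mathfrak g_n)$ is chosen so that $\mathfrak h\cap\mathfrak g_n$ is maximal toral in $\mathfrak g_n$ and $\mathfrak b\cap\mathfrak g_n$ is a Borel subalgebra of $\mathfrak g_n$. $\bar{\mathcal O}$ is the full subcategory of $\mathfrak g$-modules $M$ such that (i) $M=\bigoplus_{\lambda\in\mathfrak h^*}M^\lambda$ is an $\mathfrak h$-weight module with all weight spaces $M^\lambda$ finite-dimensional; (ii) $M$ is locally $\mathfrak n$-finite: $\dim U(\mathfrak n)\cdot v<\infty$ for all $v\in M$. Direct sums may have infinitely many summands. *)

theory Defs
  imports "HOL-Computational_Algebra.Polynomial" "HOL-Library.FuncSet"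
begin

section \<open>Direct sums and finite-dimensional subspaces\<close>

context vector_space
begin

definition fin_dim :: "'b set \<Rightarrow> bool" where
  "fin_dim V \<longleftrightarrow> (\<exists>B. finite B \<and> span B = V)"

definition direct_sum :: "'i set \<Rightarrow> ('i \<Rightarrow> 'b set) \<Rightarrow> 'b set \<Rightarrow> bool" where
  "direct_sum I W V \<longleftrightarrow>
     (\<forall>i\<in>I. subspace (W i)) \<and>
     span (\<Union>i\<in>I. W i) = V \<and>
     (\<forall>F w. finite F \<longrightarrow> F \<subseteq> I \<longrightarrow> (\<forall>i\<in>F. w i \<in> W i) \<longrightarrow> (\<Sum>i\<in>F. w i) = 0 \<longrightarrow>
        (\<forall>i\<in>F. w i = 0))"

definition complementary :: "'b set \<Rightarrow> 'b set \<Rightarrow> 'b set \<Rightarrow> bool" where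
  "complementary W W' V \<longleftrightarrow>
     subspace W \<and> subspace W' \<and> W \<inter> W' = {0} \<and> span (W \<union> W') = V"

text \<open>Linear functionals on a subspace. They are extensional (undefined off the subspace), so
  that distinct elements of the dual are distinct functions on the subspace.\<close>

definition dual :: "'b set \<Rightarrow> ('b \<Rightarrow> 'a) set" where
  "dual V = {\<alpha> \<in> extensional V.
     (\<forall>x\<in>V. \<forall>y\<in>V. \<alpha> (x + y) = \<alpha> x + \<alpha> y) \<and> (\<forall>c. \<forall>x\<in>V. \<alpha> (scale c x) = c * \<alpha> x)}"

end


section \<open>Lie algebras\<close>

locale lie_algebra = vector_space scale
  for scale :: "'k::field \<Rightarrow> 'g::ab_group_add \<Rightarrow> 'g" +
  fixes bracket :: "'g \<Rightarrow> 'g \<Rightarrow> 'g"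
  assumes linear_bracket_right: "Vector_Spaces.linear scale scale (\<lambda>y. bracket x y)"
    and linear_bracket_left: "Vector_Spaces.linear scale scale (\<lambda>x. bracket x y)"
    and bracket_self: "bracket x x = 0"
    and jacobi: "bracket x (bracket y z) + bracket y (bracket z x) + bracket z (bracket x y) = 0"
begin

definition subalgebra :: "'g set \<Rightarrow> bool" where
  "subalgebra s \<longleftrightarrow> subspace s \<and> (\<forall>x\<in>s. \<forall>y\<in>s. bracket x y \<in> s)"

definition bracket_span :: "'g set \<Rightarrow> 'g set \<Rightarrow> 'g set" where
  "bracket_span s t = span {bracket x y | x y. x \<in> s \<and> y \<in> t}"

definition solvable :: "'g set \<Rightarrow> bool" where
  "solvable s \<longleftrightarrow> subalgebra s \<and> (\<exists>n. ((\<lambda>t. bracket_span t t) ^^ n) s = {0})"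

definition nilpotent :: "'g set \<Rightarrow> bool" where
  "nilpotent s \<longleftrightarrow> subalgebra s \<and> (\<exists>n. ((\<lambda>t. bracket_span s t) ^^ n) s = {0})"

definition locally_solvable :: "'g set \<Rightarrow> bool" where
  "locally_solvable s \<longleftrightarrow> subalgebra s \<and>
     (\<forall>F. finite F \<longrightarrow> F \<subseteq> s \<longrightarrow> (\<exists>t. F \<subseteq> t \<and> t \<subseteq> s \<and> fin_dim t \<and> solvable t))"

definition normalizer :: "'g set \<Rightarrow> 'g set \<Rightarrow> 'g set" where
  "normalizer t s = {x\<in>s. \<forall>y\<in>t. bracket x y \<in> t}"

definition cartan_subalgebra :: "'g set \<Rightarrow> 'g set \<Rightarrow> bool" where
  "cartan_subalgebra t s \<longleftrightarrow> t \<subseteq> s \<and> nilpotent t \<and> normalizer t s = t"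

definition borel_subalgebra :: "'g set \<Rightarrow> 'g set \<Rightarrow> bool" where
  "borel_subalgebra t s \<longleftrightarrow> t \<subseteq> s \<and> solvable t \<and>
     (\<forall>t'. t \<subseteq> t' \<longrightarrow> t' \<subseteq> s \<longrightarrow> solvable t' \<longrightarrow> t' = t)"

definition ad_stable :: "'g set \<Rightarrow> 'g set \<Rightarrow> bool" where
  "ad_stable A W \<longleftrightarrow> subspace W \<and> (\<forall>x\<in>A. \<forall>y\<in>W. bracket x y \<in> W)"

text \<open>The operators \<open>ad x\<close>, \<open>x \<in> A\<close>, act semisimply on \<open>s\<close>: stable subspaces have stable
  complements.  For \<open>A\<close> a subalgebra this is complete reducibility of \<open>s\<close> as an \<open>A\<close>-module
  (for \<open>A = s\<close>: \<open>s\<close> is reductive); for \<open>A = {x}\<close> it is semisimplicity of the endomorphism \<open>ad x\<close>.\<close>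

definition ad_semisimple :: "'g set \<Rightarrow> 'g set \<Rightarrow> bool" where
  "ad_semisimple A s \<longleftrightarrow>
     (\<forall>W. W \<subseteq> s \<longrightarrow> ad_stable A W \<longrightarrow> (\<exists>W'. ad_stable A W' \<and> complementary W W' s))"

definition reductive_in :: "'g set \<Rightarrow> 'g set \<Rightarrow> bool" where
  "reductive_in s t \<longleftrightarrow> subalgebra s \<and> subalgebra t \<and> s \<subseteq> t \<and> ad_semisimple s t"

definition reductive :: "'g set \<Rightarrow> bool" where
  "reductive s \<longleftrightarrow> reductive_in s s"

definition toral_subalgebra :: "'g set \<Rightarrow> 'g set \<Rightarrow> bool" where
  "toral_subalgebra t s \<longleftrightarrow> t \<subseteq> s \<and> subalgebra t \<and> (\<forall>x\<in>t. ad_semisimple {x} s)"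

definition maximal_toral_subalgebra :: "'g set \<Rightarrow> 'g set \<Rightarrow> bool" where
  "maximal_toral_subalgebra t s \<longleftrightarrow> toral_subalgebra t s \<and>
     (\<forall>t'. t \<subseteq> t' \<longrightarrow> toral_subalgebra t' s \<longrightarrow> t' = t)"

definition root_space :: "'g set \<Rightarrow> 'g set \<Rightarrow> ('g \<Rightarrow> 'k) \<Rightarrow> 'g set" where
  "root_space t s \<alpha> = {x\<in>s. \<forall>h\<in>t. bracket h x = scale (\<alpha> h) x}"

definition roots :: "'g set \<Rightarrow> 'g set \<Rightarrow> ('g \<Rightarrow> 'k) set" where
  "roots t s = {\<alpha> \<in> dual t. (\<exists>h\<in>t. \<alpha> h \<noteq> 0) \<and> root_space t s \<alpha> \<noteq> {0}}"

definition root_inclusion :: "'g set \<Rightarrow> 'g set \<Rightarrow> 'g set \<Rightarrow> bool" where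
  "root_inclusion s t k \<longleftrightarrow> cartan_subalgebra (s \<inter> k) s \<and>
     (\<forall>\<alpha>\<in>roots (s \<inter> k) s. \<exists>\<beta>\<in>roots k t. root_space (s \<inter> k) s \<alpha> = root_space k t \<beta>)"

text \<open>The Lie algebra is the whole type; \<open>root_reductive_exhaustion G\<close> says that the sequence
  \<open>G\<close> witnesses that it is root-reductive.\<close>

definition root_reductive_exhaustion :: "(nat \<Rightarrow> 'g set) \<Rightarrow> bool" where
  "root_reductive_exhaustion G \<longleftrightarrow>
     (\<Union>n. G n) = UNIV \<and>
     (\<forall>n. fin_dim (G n) \<and> reductive (G n) \<and> G n \<subseteq> G (Suc n) \<and> reductive_in (G n) (G (Suc n))) \<and>
     (\<exists>K. \<forall>n. K n \<subseteq> K (Suc n) \<and> cartan_subalgebra (K n) (G n) \<and>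
        root_inclusion (G n) (G (Suc n)) (K (Suc n)))"

text \<open>In the root space decomposition the index \<open>None\<close> carries the summand \<open>h\<close> itself.\<close>

definition splitting_maximal_toral :: "'g set \<Rightarrow> bool" where
  "splitting_maximal_toral h \<longleftrightarrow> subalgebra h \<and>
     (\<exists>\<F>. \<F> \<noteq> {} \<and> (\<forall>s\<in>\<F>. \<forall>t\<in>\<F>. \<exists>u\<in>\<F>. s \<union> t \<subseteq> u) \<and> \<Union>\<F> = UNIV \<and>
        (\<forall>s\<in>\<F>. fin_dim s \<and> reductive s \<and> maximal_toral_subalgebra (h \<inter> s) s)) \<and>
     direct_sum (insert None (Some ` roots h UNIV))
       (\<lambda>i. case i of None \<Rightarrow> h | Some \<alpha> \<Rightarrow> root_space h UNIV \<alpha>) UNIV"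

definition splitting_borel :: "'g set \<Rightarrow> bool" where
  "splitting_borel b \<longleftrightarrow> locally_solvable b \<and>
     (\<forall>b'. b \<subseteq> b' \<longrightarrow> locally_solvable b' \<longrightarrow> b' = b) \<and>
     (\<exists>h. splitting_maximal_toral h \<and> h \<subseteq> b)"

end


section \<open>Modules and the category \<open>O-bar\<close>\<close>

locale lie_module = lie_algebra scale bracket + M: vector_space scaleM
  for scale :: "'k::field \<Rightarrow> 'g::ab_group_add \<Rightarrow> 'g"
    and bracket :: "'g \<Rightarrow> 'g \<Rightarrow> 'g"
    and scaleM :: "'k \<Rightarrow> 'm::ab_group_add \<Rightarrow> 'm" +
  fixes act :: "'g \<Rightarrow> 'm \<Rightarrow> 'm"
  assumes linear_act_right: "Vector_Spaces.linear scaleM scaleM (\<lambda>v. act x v)"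
    and linear_act_left: "Vector_Spaces.linear scale scaleM (\<lambda>x. act x v)"
    and act_bracket: "act (bracket x y) v = act x (act y v) - act y (act x v)"
begin

definition submodule :: "'m set \<Rightarrow> bool" where
  "submodule V \<longleftrightarrow> M.subspace V \<and> (\<forall>x. \<forall>v\<in>V. act x v \<in> V)"

definition weight_space :: "'g set \<Rightarrow> 'm set \<Rightarrow> ('g \<Rightarrow> 'k) \<Rightarrow> 'm set" where
  "weight_space h V \<mu> = {v\<in>V. \<forall>x\<in>h. act x v = scaleM (\<mu> x) v}"

text \<open>The image of the universal enveloping algebra \<open>U(s)\<close> in the endomorphisms of the module,
  that is, the unital associative algebra of operators generated by the action of \<open>s\<close>.\<close>

inductive_set env_image :: "'g set \<Rightarrow> ('m \<Rightarrow> 'm) set" for s :: "'g set" where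
  one: "id \<in> env_image s"
| gen: "x \<in> s \<Longrightarrow> act x \<in> env_image s"
| add: "f \<in> env_image s \<Longrightarrow> g \<in> env_image s \<Longrightarrow> (\<lambda>v. f v + g v) \<in> env_image s"
| scale: "f \<in> env_image s \<Longrightarrow> (\<lambda>v. scaleM c (f v)) \<in> env_image s"
| comp: "f \<in> env_image s \<Longrightarrow> g \<in> env_image s \<Longrightarrow> f \<circ> g \<in> env_image s"

definition env_orbit :: "'g set \<Rightarrow> 'm \<Rightarrow> 'm set" where
  "env_orbit s v = {f v | f. f \<in> env_image s}"

definition obar_object :: "'g set \<Rightarrow> 'g set \<Rightarrow> 'm set \<Rightarrow> bool" where
  "obar_object h b V \<longleftrightarrow> submodule V \<and>
     M.direct_sum (dual h) (weight_space h V) V \<and>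
     (\<forall>\<mu>\<in>dual h. M.fin_dim (weight_space h V \<mu>)) \<and>
     (\<forall>v\<in>V. M.fin_dim (env_orbit (bracket_span b b) v))"

definition obar_indecomposable :: "'g set \<Rightarrow> 'g set \<Rightarrow> 'm set \<Rightarrow> bool" where
  "obar_indecomposable h b V \<longleftrightarrow> obar_object h b V \<and> V \<noteq> {0} \<and>
     (\<forall>V1 V2. obar_object h b V1 \<longrightarrow> obar_object h b V2 \<longrightarrow> M.complementary V1 V2 V \<longrightarrow>
        V1 = {0} \<or> V2 = {0})"

end

end

theory Submission
  imports Defs
begin

text \<open>
  A weight module with finite-dimensional weight spaces behaves like a finite-dimensional module as
  long as one looks at one weight at a time: a chain of submodules becomes stationary on each
  single weight space, although it need not become stationary as a whole.  This gives the key
  fact, \<open>summand_pair_chain\<close>: for a chain of decompositions \<open>M = N \<oplus> D\<close> into submodules, with \<open>N\<close>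
  decreasing while \<open>D\<close> increases, the intersection of all \<open>N\<close> and the union of all \<open>D\<close> are again
  complementary.  Only spanning is in question, and a vector of weight \<open>\<mu>\<close> can be decomposed at a
  member of the chain where \<open>N\<close> has reached its final \<open>\<mu>\<close>-weight space.

  With this fact Zorn's lemma applies twice.

  In \<open>indecomposable_summand\<close>, fix a weight \<open>\<mu>\<close> of a nonzero summand \<open>C\<close> and shrink \<open>C\<close>, as a
  summand, as long as its \<open>\<mu>\<close>-weight space does not vanish.  The weight space cannot vanish in the
  limit either, since it is stationary along a chain.  A minimal such summand is indecomposable: if
  it split, one of the parts would still have the weight \<open>\<mu>\<close>, and so would be all of it.

  In \<open>direct_sum_of_indecomposables\<close>, take a maximal independent family \<open>S\<close> of indecomposables
  together with a complement \<open>C\<close> of its sum, where enlarging means adding to \<open>S\<close> and shrinking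
  \<open>C\<close>.  If \<open>C\<close> were nonzero, an indecomposable summand of \<open>C\<close> could be moved from \<open>C\<close> to \<open>S\<close>.
  The complement is part of the data so that the complements along a chain are nested, as the key
  fact demands.

  All submodules met on the way are objects of the category again
  (\<open>obar_object_submodule\<close>), because a submodule contains the weight components of its vectors.
\<close>

section \<open>Complements and direct sums of subspaces\<close>

context vector_space
begin

lemma fin_dim_subspace:
  assumes "fin_dim V" "subspace W" "W \<subseteq> V"
  shows "fin_dim W"
proof -
  obtain B where B: "finite B" "span B = V"
    using assms(1) unfolding fin_dim_def by blast
  obtain C where C: "C \<subseteq> W" "independent C" "W \<subseteq> span C"
    using maximal_independent_subset[of W] by blast
  have "C \<subseteq> span B"
    using C(1) assms(3) B(2) by blast
  then have "finite C"
    using independent_span_bound[OF B(1) C(2)] by blast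
  moreover have "span C = W"
    using C span_minimal[OF C(1) assms(2)] by blast
  ultimately show ?thesis
    unfolding fin_dim_def by blast
qed

lemma subspace_eq_if_dim_le:
  assumes "fin_dim V" "subspace V" "subspace W" "W \<subseteq> V" "dim V \<le> dim W"
  shows "W = V"
proof -
  obtain B where B: "B \<subseteq> W" "independent B" "W \<subseteq> span B"
    using maximal_independent_subset[of W] by blast
  obtain C where C: "B \<subseteq> C" "C \<subseteq> V" "independent C" "V \<subseteq> span C"
    using maximal_independent_subset_extend[of B V] B assms(4) by blast
  obtain E where E: "finite E" "span E = V"
    using assms(1) unfolding fin_dim_def by blast
  have "finite C"
    using independent_span_bound[OF E(1) C(3)] C(2) E(2) by blast
  moreover have "card C \<le> card B"
    using assms(5) basis_card_eq_dim[OF C(2,4,3)] basis_card_eq_dim[OF B(1,3,2)] by simp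
  ultimately have "B = C"
    using C(1) by (simp add: card_seteq)
  then have "V \<subseteq> span B"
    using C(4) by simp
  also have "span B \<subseteq> W"
    by (rule span_minimal[OF B(1) assms(3)])
  finally show ?thesis
    using assms(4) by blast
qed

lemma complementary_unique:
  assumes "complementary W W' V" "w \<in> W" "w' \<in> W'" "u \<in> W" "u' \<in> W'" "w + w' = u + u'"
  shows "w = u" "w' = u'"
proof -
  have sub: "subspace W" "subspace W'" and int: "W \<inter> W' = {0}"
    using assms(1) unfolding complementary_def by auto
  have "w - u = u' - w'"
    using assms(6) by (simp add: algebra_simps)
  moreover have "w - u \<in> W" "u' - w' \<in> W'"
    using sub assms by (auto intro: subspace_diff)
  ultimately have "w - u \<in> W \<inter> W'"
    by simp
  then have *: "w - u = 0"
    using int by blast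
  then show "w = u"
    by simp
  with assms(6) show "w' = u'"
    by simp
qed

lemma complementary_decompose:
  assumes "complementary W W' V" "v \<in> V"
  obtains w w' where "w \<in> W" "w' \<in> W'" "v = w + w'"
proof -
  have "v \<in> span (W \<union> W')" "span W = W" "span W' = W'"
    using assms span_eq_iff unfolding complementary_def by auto
  then show ?thesis
    unfolding span_Un using that by auto
qed

lemma complementaryI:
  assumes "subspace W" "subspace W'" "\<And>v. v \<in> W \<Longrightarrow> v \<in> W' \<Longrightarrow> v = 0"
    and "W \<subseteq> V" "W' \<subseteq> V" "subspace V"
    and "\<And>v. v \<in> V \<Longrightarrow> \<exists>w\<in>W. \<exists>w'\<in>W'. v = w + w'"
  shows "complementary W W' V"
  unfolding complementary_def
proof (intro conjI)
  show "W \<inter> W' = {0}"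
    using assms(1-3) subspace_0 by blast
  have "v \<in> span (W \<union> W')" if v: "v \<in> V" for v
  proof -
    obtain w w' where "w \<in> W" "w' \<in> W'" "v = w + w'"
      using assms(7)[OF v] by blast
    then show ?thesis
      by (simp add: span_add span_base)
  qed
  then show "span (W \<union> W') = V"
    using span_minimal[of "W \<union> W'" V] assms(4-6) by blast
qed (fact assms)+

lemma complementary_commute:
  "complementary W W' V \<longleftrightarrow> complementary W' W V"
  unfolding complementary_def by (auto simp: Un_commute)

text \<open>If \<open>V = N \<oplus> D\<close> and \<open>N = A \<oplus> B\<close>, then \<open>V = A \<oplus> (B \<oplus> D)\<close>: this is how a summand is made
  smaller while its complement grows.\<close>

lemma complementary_regroup:
  assumes "complementary N D UNIV" "complementary A B N"
  shows "complementary A (span (B \<union> D)) UNIV"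
proof -
  have sub: "subspace N" "subspace D" "subspace A" "subspace B" and AB: "span (A \<union> B) = N"
    using assms unfolding complementary_def by auto
  have BD: "span (B \<union> D) = {y. \<exists>x\<in>B. \<exists>d\<in>D. y = x + d}"
  proof -
    have *: "span B = B" "span D = D"
      using sub by auto
    show ?thesis
      unfolding span_Un * by blast
  qed
  have AN: "A \<subseteq> N" "B \<subseteq> N"
    using AB span_superset[of "A \<union> B"] by auto
  show ?thesis
  proof (rule complementaryI)
    show "v = 0" if v: "v \<in> A" "v \<in> span (B \<union> D)" for v
    proof -
      obtain x d where x: "x \<in> B" "d \<in> D" "v = x + d"
        using v(2) BD by blast
      have "v = x"
      proof (rule complementary_unique(1)[OF assms(1)])
        show "v + 0 = x + d"
          using x(3) by simp
      qed (use v x AN sub subspace_0 in auto)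
      then have "v \<in> A \<inter> B"
        using v(1) x(1) by simp
      then show ?thesis
        using assms(2) unfolding complementary_def by auto
    qed
    show "\<exists>w\<in>A. \<exists>w'\<in>span (B \<union> D). v = w + w'" for v
    proof -
      obtain n d where n: "n \<in> N" "d \<in> D" "v = n + d"
        using complementary_decompose[OF assms(1), of v] by auto
      obtain x y where x: "x \<in> A" "y \<in> B" "n = x + y"
        using complementary_decompose[OF assms(2) n(1)] by auto
      have "v = x + (y + d)"
        using n(3) x(3) by (simp add: algebra_simps)
      moreover have "y + d \<in> span (B \<union> D)"
        using BD x(2) n(2) by auto
      ultimately show ?thesis
        using x(1) by blast
    qed
  qed (use sub in auto)
qed

text \<open>A summand \<open>N\<close> of the whole space that lies in \<open>C\<close> splits off from \<open>C\<close>, with complement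
  \<open>C \<inter> D\<close> by the modular law, and can then be moved to the other side of \<open>C \<oplus> E\<close>.\<close>

lemma complementary_modular:
  assumes "complementary C E UNIV" "complementary N D UNIV" "N \<subseteq> C" "E \<subseteq> D"
  shows "complementary (C \<inter> D) (span (N \<union> E)) UNIV"
proof -
  have sub: "subspace C" "subspace E" "subspace N" "subspace D"
    using assms unfolding complementary_def by auto
  have "complementary N (C \<inter> D) C"
  proof (rule complementaryI)
    show "v = 0" if "v \<in> N" "v \<in> C \<inter> D" for v
      using that assms(2) unfolding complementary_def by auto
    show "\<exists>w\<in>N. \<exists>w'\<in>C \<inter> D. v = w + w'" if "v \<in> C" for v
    proof -
      obtain n d where n: "n \<in> N" "d \<in> D" "v = n + d"
        using complementary_decompose[OF assms(2), of v] by auto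
      have "v - n \<in> C"
        using that n(1) assms(3) sub(1) by (auto intro: subspace_diff)
      then show ?thesis
        using n by auto
    qed
  qed (use sub assms(3) subspace_inter in auto)
  then have "complementary (C \<inter> D) N C"
    by (simp add: complementary_commute)
  then show ?thesis
    by (rule complementary_regroup[OF assms(1)])
qed

lemma direct_sum_zero:
  assumes "direct_sum I W V" "finite F" "F \<subseteq> I" "\<forall>i\<in>F. w i \<in> W i" "(\<Sum>i\<in>F. w i) = 0"
  shows "\<forall>i\<in>F. w i = 0"
proof -
  have "\<forall>F w. finite F \<longrightarrow> F \<subseteq> I \<longrightarrow> (\<forall>i\<in>F. w i \<in> W i) \<longrightarrow> (\<Sum>i\<in>F. w i) = 0 \<longrightarrow>
      (\<forall>i\<in>F. w i = 0)"
    using assms(1) unfolding direct_sum_def by (elim conjE)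
  from this[rule_format, of F w] show ?thesis
    using assms(2-5) by simp
qed

lemma direct_sum_insert:
  assumes "direct_sum S (\<lambda>N. N) (span (\<Union>S))" "subspace N" "N \<inter> span (\<Union>S) = {0}"
  shows "direct_sum (insert N S) (\<lambda>N. N) (span (\<Union>(insert N S)))"
  unfolding direct_sum_def
proof (intro conjI allI impI)
  show "\<forall>i\<in>insert N S. subspace i"
    using assms(1,2) unfolding direct_sum_def by auto
  show "span (\<Union>i\<in>insert N S. i) = span (\<Union>(insert N S))"
    by simp
next
  fix F w
  assume F: "finite F" "F \<subseteq> insert N S" and w: "\<forall>i\<in>F. w i \<in> i" and sum0: "(\<Sum>i\<in>F. w i) = 0"
  have ind: "\<forall>i\<in>F'. w i = 0" if "F' \<subseteq> F" "F' \<subseteq> S" "(\<Sum>i\<in>F'. w i) = 0" for F'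
    by (rule direct_sum_zero[OF assms(1) finite_subset[OF that(1) F(1)] that(2) _ that(3)])
      (use that(1) w in blast)
  show "\<forall>i\<in>F. w i = 0"
  proof (cases "N \<in> F")
    case True
    have rest: "(\<Sum>i\<in>F - {N}. w i) \<in> span (\<Union>S)"
      using F(2) w by (intro span_sum span_base) blast
    have split: "w N + (\<Sum>i\<in>F - {N}. w i) = 0"
      using sum0 F(1) True by (simp add: sum.remove)
    then have "w N = - (\<Sum>i\<in>F - {N}. w i)"
      by (rule eq_neg_iff_add_eq_0[THEN iffD2])
    then have "w N \<in> N \<inter> span (\<Union>S)"
      using rest w True by (auto intro: span_neg)
    then have wN: "w N = 0"
      using assms(3) by blast
    moreover have "\<forall>i\<in>F - {N}. w i = 0"
      by (rule ind) (use F(2) split wN in auto)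
    ultimately show ?thesis
      by blast
  next
    case False
    show ?thesis
      by (rule ind) (use False F(2) sum0 in auto)
  qed
qed

text \<open>Independence has finite character: a finite subfamily of the union of a chain already lies in
  one member of the chain.\<close>

lemma direct_sum_Union_chain:
  assumes "\<And>S. S \<in> \<C> \<Longrightarrow> direct_sum S (\<lambda>N. N) (span (\<Union>S))"
    and "\<And>S T. S \<in> \<C> \<Longrightarrow> T \<in> \<C> \<Longrightarrow> S \<subseteq> T \<or> T \<subseteq> S" and "\<C> \<noteq> {}"
  shows "direct_sum (\<Union>\<C>) (\<lambda>N. N) (span (\<Union>(\<Union>\<C>)))"
  unfolding direct_sum_def
proof (intro conjI allI impI)
  show "\<forall>i\<in>\<Union>\<C>. subspace i"
    using assms(1) unfolding direct_sum_def by auto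
  show "span (\<Union>i\<in>\<Union>\<C>. i) = span (\<Union>(\<Union>\<C>))"
    by simp
next
  fix F w
  assume F: "finite F" "F \<subseteq> \<Union>\<C>" and w: "\<forall>i\<in>F. w i \<in> i" and sum0: "(\<Sum>i\<in>F. w i) = 0"
  have "subset.chain UNIV \<C>"
    using assms(2) by (auto simp: subset_chain_def)
  then obtain S where "S \<in> \<C>" "F \<subseteq> S"
    using finite_subset_Union_chain[OF F assms(3)] by blast
  then show "\<forall>i\<in>F. w i = 0"
    using direct_sum_zero[OF assms(1) F(1) _ w sum0] by simp
qed

lemma subspace_Union_chain:
  assumes "\<And>i. i \<in> I \<Longrightarrow> subspace (D i)"
    and "\<And>i j. i \<in> I \<Longrightarrow> j \<in> I \<Longrightarrow> D i \<subseteq> D j \<or> D j \<subseteq> D i" and "I \<noteq> {}"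
  shows "subspace (\<Union>i\<in>I. D i)"
proof (rule subspaceI)
  show "0 \<in> (\<Union>i\<in>I. D i)"
    using assms(1,3) subspace_0 by blast
  show "scale c x \<in> (\<Union>i\<in>I. D i)" if "x \<in> (\<Union>i\<in>I. D i)" for c x
    using that assms(1) subspace_scale by blast
  show "x + y \<in> (\<Union>i\<in>I. D i)" if xy: "x \<in> (\<Union>i\<in>I. D i)" "y \<in> (\<Union>i\<in>I. D i)" for x y
  proof -
    obtain i j where ij: "i \<in> I" "x \<in> D i" "j \<in> I" "y \<in> D j"
      using xy by blast
    then show ?thesis
      using assms(2)[OF ij(1,3)] assms(1) subspace_add by blast
  qed
qed

end

section \<open>Weight components and submodules\<close>

locale obar_module = lie_module scale bracket scaleM act
  for scale :: "'k::field \<Rightarrow> 'g::ab_group_add \<Rightarrow> 'g"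
    and bracket :: "'g \<Rightarrow> 'g \<Rightarrow> 'g"
    and scaleM :: "'k \<Rightarrow> 'm::ab_group_add \<Rightarrow> 'm"
    and act :: "'g \<Rightarrow> 'm \<Rightarrow> 'm" +
  fixes h b :: "'g set"
  assumes obar_UNIV: "obar_object h b UNIV"
begin

lemma act_add: "act x (v + w) = act x v + act x w"
  and act_scale: "act x (scaleM c v) = scaleM c (act x v)"
  and act_0: "act x 0 = 0"
  and act_sum: "act x (\<Sum>i\<in>F. f i) = (\<Sum>i\<in>F. act x (f i))"
proof -
  interpret A: Vector_Spaces.linear scaleM scaleM "act x"
    by (rule linear_act_right)
  show "act x (v + w) = act x v + act x w" "act x (scaleM c v) = scaleM c (act x v)"
    "act x 0 = 0" "act x (\<Sum>i\<in>F. f i) = (\<Sum>i\<in>F. act x (f i))"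
    by (rule A.add A.scale A.zero A.sum)+
qed

lemma subspace_weight_space:
  assumes "M.subspace V"
  shows "M.subspace (weight_space h V \<mu>)"
  using assms unfolding M.subspace_def weight_space_def
  by (auto simp: act_add act_scale act_0 M.scale_right_distrib M.scale_left_commute)

lemma fin_dim_weight_space:
  assumes "M.subspace V" "\<mu> \<in> dual h"
  shows "M.fin_dim (weight_space h V \<mu>)"
proof (rule M.fin_dim_subspace)
  show "M.fin_dim (weight_space h UNIV \<mu>)"
    using obar_UNIV assms(2) unfolding obar_object_def by blast
qed (auto simp: subspace_weight_space assms(1), auto simp: weight_space_def)

lemma span_weight_spaces: "M.span (\<Union>\<mu>\<in>dual h. weight_space h UNIV \<mu>) = UNIV"
  using obar_UNIV unfolding obar_object_def M.direct_sum_def by blast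

lemma sum_of_weight_vectors:
  obtains F w where "finite F" "F \<subseteq> dual h" "\<forall>\<mu>\<in>F. w \<mu> \<in> weight_space h UNIV \<mu>"
    "v = (\<Sum>\<mu>\<in>F. w \<mu>)"
proof -
  let ?W = "\<lambda>\<mu>. weight_space h UNIV \<mu>"
  have "v \<in> M.span (\<Union>\<mu>\<in>dual h. ?W \<mu>)"
    using span_weight_spaces by simp
  then have "\<exists>F w. finite F \<and> F \<subseteq> dual h \<and> (\<forall>\<mu>. w \<mu> \<in> ?W \<mu>) \<and> v = (\<Sum>\<mu>\<in>F. w \<mu>)"
  proof (induction rule: M.span_induct_alt)
    case base
    show ?case
      by (rule exI[of _ "{}"], rule exI[of _ "\<lambda>_. 0"]) (simp add: M.subspace_0 subspace_weight_space)
  next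
    case (step c x y)
    then obtain F w where F: "finite F" "F \<subseteq> dual h" "\<forall>\<mu>. w \<mu> \<in> ?W \<mu>" "y = (\<Sum>\<mu>\<in>F. w \<mu>)"
      by blast
    obtain \<nu> where \<nu>: "\<nu> \<in> dual h" "x \<in> ?W \<nu>"
      using step by blast
    define w' where "w' \<mu> = (if \<mu> = \<nu> then scaleM c x else 0) + (if \<mu> \<in> F then w \<mu> else 0)" for \<mu>
    have sub: "M.subspace (?W \<mu>)" for \<mu>
      by (simp add: subspace_weight_space)
    have "w' \<mu> \<in> ?W \<mu>" for \<mu>
      using F(3) \<nu>(2) M.subspace_0[OF sub] M.subspace_add[OF sub] M.subspace_scale[OF sub]
      by (auto simp: w'_def)
    moreover have "scaleM c x + y = (\<Sum>\<mu>\<in>insert \<nu> F. w' \<mu>)"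
    proof -
      have "(\<Sum>\<mu>\<in>insert \<nu> F. w' \<mu>) = (\<Sum>\<mu>\<in>insert \<nu> F. if \<mu> = \<nu> then scaleM c x else 0)
          + (\<Sum>\<mu>\<in>insert \<nu> F. if \<mu> \<in> F then w \<mu> else 0)"
        unfolding w'_def by (rule sum.distrib)
      also have "(\<Sum>\<mu>\<in>insert \<nu> F. if \<mu> = \<nu> then scaleM c x else 0) = scaleM c x"
        using F(1) by (subst sum.delta) auto
      also have "(\<Sum>\<mu>\<in>insert \<nu> F. if \<mu> \<in> F then w \<mu> else 0) = y"
        unfolding F(4) using F(1) by (intro sum.mono_neutral_cong_right) auto
      finally show ?thesis
        by simp
    qed
    ultimately show ?case
      using F(1,2) \<nu>(1) by (intro exI[of _ "insert \<nu> F"] exI[of _ w']) auto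
  qed
  then show ?thesis
    using that by blast
qed

text \<open>Distinct weights are separated by some \<open>x \<in> h\<close>, so that \<open>x - \<nu>(x)\<close> kills the component of
  weight \<open>\<nu>\<close> and multiplies the one of weight \<open>\<mu>\<close> by a nonzero scalar; the number of components
  drops, and induction applies.\<close>

lemma weight_components_in_submodule:
  assumes "submodule V" "finite F" "F \<subseteq> dual h"
    and "\<And>\<mu>. \<mu> \<in> F \<Longrightarrow> w \<mu> \<in> weight_space h UNIV \<mu>" "(\<Sum>\<mu>\<in>F. w \<mu>) \<in> V"
  shows "\<forall>\<mu>\<in>F. w \<mu> \<in> V"
  using assms(2-5)
proof (induction F arbitrary: w rule: finite_induct)
  case empty
  then show ?case
    by simp
next
  case (insert \<nu> F)
  have V: "M.subspace V" "\<And>x v. v \<in> V \<Longrightarrow> act x v \<in> V"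
    using assms(1) unfolding submodule_def by auto
  let ?s = "\<Sum>\<mu>\<in>insert \<nu> F. w \<mu>"
  have F: "w \<mu> \<in> V" if \<mu>: "\<mu> \<in> F" for \<mu>
  proof -
    have "\<mu> \<noteq> \<nu>" "\<mu> \<in> extensional h" "\<nu> \<in> extensional h"
      using \<mu> insert.hyps(2) insert.prems(1) unfolding dual_def by auto
    \<comment> \<open>Weights are undefined off \<open>h\<close>, hence two different ones differ at a point of \<open>h\<close>.\<close>
    then obtain x where x: "x \<in> h" "\<mu> x \<noteq> \<nu> x"
      using extensionalityI by blast
    define w' where "w' \<kappa> = scaleM (\<kappa> x - \<nu> x) (w \<kappa>)" for \<kappa>
    have "act x ?s = (\<Sum>\<kappa>\<in>insert \<nu> F. scaleM (\<kappa> x) (w \<kappa>))"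
      unfolding act_sum using insert.prems(2) x(1) by (intro sum.cong) (auto simp: weight_space_def)
    then have "act x ?s - scaleM (\<nu> x) ?s = (\<Sum>\<kappa>\<in>insert \<nu> F. w' \<kappa>)"
      unfolding M.scale_sum_right w'_def by (simp add: sum_subtractf M.scale_left_diff_distrib)
    also have "\<dots> = (\<Sum>\<kappa>\<in>F. w' \<kappa>)"
      using insert.hyps by (simp add: w'_def)
    finally have "(\<Sum>\<kappa>\<in>F. w' \<kappa>) = act x ?s - scaleM (\<nu> x) ?s"
      by simp
    also have "\<dots> \<in> V"
      using insert.prems(3) V by (intro M.subspace_diff M.subspace_scale) auto
    finally have "(\<Sum>\<kappa>\<in>F. w' \<kappa>) \<in> V" .
    moreover have "w' \<kappa> \<in> weight_space h UNIV \<kappa>" if "\<kappa> \<in> F" for \<kappa>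
      unfolding w'_def using insert.prems(2) that
      by (intro M.subspace_scale subspace_weight_space) auto
    ultimately have "w' \<mu> \<in> V"
      using insert.IH[of w'] insert.prems(1) \<mu> by blast
    then have "scaleM (inverse (\<mu> x - \<nu> x)) (w' \<mu>) \<in> V"
      by (rule M.subspace_scale[OF V(1)])
    then show ?thesis
      using x(2) by (simp add: w'_def)
  qed
  have "?s - (\<Sum>\<mu>\<in>F. w \<mu>) \<in> V"
    by (rule M.subspace_diff[OF V(1) insert.prems(3) M.subspace_sum[OF V(1) F]])
  then show ?case
    using insert.hyps F by simp
qed

lemma obar_object_submodule:
  assumes "submodule V"
  shows "obar_object h b V"
proof -
  have V: "M.subspace V"
    using assms unfolding submodule_def by blast
  let ?W = "weight_space h V"
  have "v \<in> M.span (\<Union>\<mu>\<in>dual h. ?W \<mu>)" if v: "v \<in> V" for v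
  proof -
    obtain F w where F: "finite F" "F \<subseteq> dual h"
      "\<forall>\<mu>\<in>F. w \<mu> \<in> weight_space h UNIV \<mu>" "v = (\<Sum>\<mu>\<in>F. w \<mu>)"
      by (rule sum_of_weight_vectors[of v])
    have "\<forall>\<mu>\<in>F. w \<mu> \<in> V"
      by (rule weight_components_in_submodule[OF assms F(1,2)]) (use v F(3,4) in auto)
    then have "\<forall>\<mu>\<in>F. w \<mu> \<in> ?W \<mu>"
      using F(3) unfolding weight_space_def by auto
    then show ?thesis
      unfolding F(4) using F(2) by (intro M.span_sum M.span_base) auto
  qed
  moreover have "M.span (\<Union>\<mu>\<in>dual h. ?W \<mu>) \<subseteq> V"
    by (rule M.span_minimal[OF _ V]) (auto simp: weight_space_def)
  ultimately have "M.span (\<Union>\<mu>\<in>dual h. ?W \<mu>) = V"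
    by blast
  moreover have "\<forall>i\<in>F. w i = 0"
    if "finite F" "F \<subseteq> dual h" "\<forall>i\<in>F. w i \<in> ?W i" "(\<Sum>i\<in>F. w i) = 0" for F w
  proof -
    have "\<forall>i\<in>F. w i \<in> weight_space h UNIV i"
      using that(3) unfolding weight_space_def by auto
    then show ?thesis
      using M.direct_sum_zero[of "dual h" "weight_space h UNIV" UNIV F w] obar_UNIV that
      unfolding obar_object_def by blast
  qed
  ultimately have "M.direct_sum (dual h) ?W V"
    unfolding M.direct_sum_def using subspace_weight_space[OF V] by (intro conjI allI impI) auto
  then show ?thesis
    using assms fin_dim_weight_space[OF V] obar_UNIV unfolding obar_object_def by blast
qed

section \<open>Chains of decompositions\<close>

definition summand_pair :: "'m set \<Rightarrow> 'm set \<Rightarrow> bool" where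
  "summand_pair N D \<longleftrightarrow> submodule N \<and> submodule D \<and> M.complementary N D UNIV"

text \<open>The components of a weight vector have the same weight, because each \<open>x \<in> h\<close> preserves both
  summands and components are unique.\<close>

lemma weight_vector_components:
  assumes "submodule N" "submodule D" "M.complementary N D V" "n \<in> N" "d \<in> D"
    and "n + d \<in> weight_space h UNIV \<mu>"
  shows "n \<in> weight_space h N \<mu>" "d \<in> weight_space h D \<mu>"
proof -
  have sub: "M.subspace N" "M.subspace D"
    using assms(1,2) unfolding submodule_def by auto
  have "act x n = scaleM (\<mu> x) n \<and> act x d = scaleM (\<mu> x) d" if "x \<in> h" for x
  proof -
    have "act x n + act x d = scaleM (\<mu> x) n + scaleM (\<mu> x) d"
      using assms(6) that unfolding weight_space_def
      by (simp add: act_add M.scale_right_distrib)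
    moreover have "act x n \<in> N" "act x d \<in> D" "scaleM (\<mu> x) n \<in> N" "scaleM (\<mu> x) d \<in> D"
      using assms(1,2,4,5) sub M.subspace_scale unfolding submodule_def by auto
    ultimately show ?thesis
      using M.complementary_unique[OF assms(3)] by blast
  qed
  then show "n \<in> weight_space h N \<mu>" "d \<in> weight_space h D \<mu>"
    using assms(4,5) unfolding weight_space_def by auto
qed

text \<open>A member of the chain whose \<open>\<mu>\<close>-weight space has the least dimension has a \<open>\<mu>\<close>-weight space
  contained in that of every other member.\<close>

lemma chain_weight_space_stabilizes:
  assumes "\<And>i. i \<in> I \<Longrightarrow> submodule (N i)"
    and "\<And>i j. i \<in> I \<Longrightarrow> j \<in> I \<Longrightarrow> N i \<subseteq> N j \<or> N j \<subseteq> N i"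
    and "I \<noteq> {}" "\<mu> \<in> dual h"
  obtains i where "i \<in> I" "weight_space h (N i) \<mu> = weight_space h (\<Inter>j\<in>I. N j) \<mu>"
proof -
  let ?W = "\<lambda>i. weight_space h (N i) \<mu>"
  obtain i0 where "i0 \<in> I"
    using assms(3) by blast
  then obtain i where i: "i \<in> I" "\<And>j. j \<in> I \<Longrightarrow> M.dim (?W i) \<le> M.dim (?W j)"
    using ex_has_least_nat[of "\<lambda>i. i \<in> I" i0 "\<lambda>i. M.dim (?W i)"] by blast
  have sub: "M.subspace (N j)" if "j \<in> I" for j
    using assms(1)[OF that] unfolding submodule_def by blast
  have "?W i \<subseteq> ?W j" if j: "j \<in> I" for j
  proof (cases "N i \<subseteq> N j")
    case True
    then show ?thesis
      unfolding weight_space_def by blast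
  next
    case False
    then have "?W j \<subseteq> ?W i"
      using assms(2)[OF i(1) j] unfolding weight_space_def by blast
    then have "?W j = ?W i"
      using sub[OF i(1)] sub[OF j] i(2)[OF j] assms(4)
      by (intro M.subspace_eq_if_dim_le fin_dim_weight_space subspace_weight_space)
    then show ?thesis
      by simp
  qed
  then have "?W i = weight_space h (\<Inter>j\<in>I. N j) \<mu>"
    using i(1) unfolding weight_space_def by blast
  then show ?thesis
    using that i(1) by blast
qed

text \<open>It suffices to decompose weight vectors, since they span.  For weight \<open>\<mu>\<close>, decompose along a
  member \<open>i\<close> of the chain at which the \<open>\<mu>\<close>-weight spaces of \<open>N\<close> have become stationary: the component in
  \<open>N i\<close> has weight \<open>\<mu>\<close>, so it lies in the whole intersection.\<close>

lemma summand_pair_chain: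
  assumes pair: "\<And>i. i \<in> I \<Longrightarrow> summand_pair (N i) (D i)"
    and chain: "\<And>i j. i \<in> I \<Longrightarrow> j \<in> I \<Longrightarrow>
      N j \<subseteq> N i \<and> D i \<subseteq> D j \<or> N i \<subseteq> N j \<and> D j \<subseteq> D i"
    and "I \<noteq> {}"
  shows "summand_pair (\<Inter>i\<in>I. N i) (\<Union>i\<in>I. D i)"
proof -
  let ?N = "\<Inter>i\<in>I. N i" and ?D = "\<Union>i\<in>I. D i"
  have subm: "submodule (N i)" "submodule (D i)" "M.complementary (N i) (D i) UNIV"
    if "i \<in> I" for i
    using pair[OF that] unfolding summand_pair_def by auto
  have subD: "M.subspace ?D"
  proof (rule M.subspace_Union_chain)
    show "D i \<subseteq> D j \<or> D j \<subseteq> D i" if "i \<in> I" "j \<in> I" for i j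
      using chain[OF that] by blast
  qed (use subm assms(3) in \<open>auto simp: submodule_def\<close>)
  have subN: "M.subspace ?N"
    by (rule M.subspace_Inter) (use subm in \<open>auto simp: submodule_def\<close>)
  have "M.complementary ?N ?D UNIV"
  proof (rule M.complementaryI)
    show "v = 0" if "v \<in> ?N" "v \<in> ?D" for v
      using that subm(3) unfolding M.complementary_def by blast
    have "weight_space h UNIV \<mu> \<subseteq> M.span (?N \<union> ?D)" if \<mu>: "\<mu> \<in> dual h" for \<mu>
    proof
      fix v assume v: "v \<in> weight_space h UNIV \<mu>"
      obtain i where i: "i \<in> I" "weight_space h (N i) \<mu> = weight_space h ?N \<mu>"
        using chain_weight_space_stabilizes[of I N \<mu>] subm(1) chain assms(3) \<mu> by metis
      obtain n d where nd: "n \<in> N i" "d \<in> D i" "v = n + d"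
        using M.complementary_decompose[OF subm(3)[OF i(1)], of v] by auto
      have "n \<in> weight_space h (N i) \<mu>"
        by (rule weight_vector_components(1)[OF subm[OF i(1)] nd(1,2)]) (use v nd(3) in simp)
      then have "n \<in> ?N"
        using i(2) unfolding weight_space_def by auto
      then show "v \<in> M.span (?N \<union> ?D)"
        unfolding nd(3) using nd(2) i(1) by (intro M.span_add M.span_base) auto
    qed
    then have "M.span (\<Union>\<mu>\<in>dual h. weight_space h UNIV \<mu>) \<subseteq> M.span (?N \<union> ?D)"
      by (intro M.span_minimal M.subspace_span) blast
    then have span: "v \<in> M.span (?N \<union> ?D)" for v
      unfolding span_weight_spaces by blast
    have *: "M.span ?N = ?N" "M.span ?D = ?D"
      using subN subD M.span_eq_iff by blast+
    show "\<exists>w\<in>?N. \<exists>w'\<in>?D. v = w + w'" for v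
      using span[of v] unfolding M.span_Un * by blast
  qed (use subN subD in auto)
  moreover have "act x v \<in> N i" if "i \<in> I" "v \<in> N i" for x v i
    using subm(1)[OF that(1)] that(2) unfolding submodule_def by blast
  then have "submodule ?N"
    using subN unfolding submodule_def by auto
  moreover have "act x v \<in> D i" if "i \<in> I" "v \<in> D i" for x v i
    using subm(2)[OF that(1)] that(2) unfolding submodule_def by blast
  then have "submodule ?D"
    using subD unfolding submodule_def by auto
  ultimately show ?thesis
    unfolding summand_pair_def by blast
qed

section \<open>Indecomposable summands\<close>

lemma submodule_span_Union:
  assumes "\<And>N. N \<in> S \<Longrightarrow> submodule N"
  shows "submodule (M.span (\<Union>S))"
  unfolding submodule_def
proof (intro conjI allI ballI)
  fix x v assume "v \<in> M.span (\<Union>S)"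
  then show "act x v \<in> M.span (\<Union>S)"
  proof (induction rule: M.span_induct_alt)
    case base
    then show ?case
      by (simp add: act_0 M.span_zero)
  next
    case (step c y z)
    then have "act x y \<in> \<Union>S"
      using assms unfolding submodule_def by blast
    then show ?case
      unfolding act_add act_scale
      by (rule M.span_add[OF M.span_scale[OF M.span_base] step.IH])
  qed
qed simp

lemma submodule_span_Un:
  assumes "submodule A" "submodule B"
  shows "submodule (M.span (A \<union> B))"
  using submodule_span_Union[of "{A, B}"] assms by auto

lemma nonzero_weight_space:
  assumes "submodule V" "V \<noteq> {0}"
  obtains \<mu> where "\<mu> \<in> dual h" "weight_space h V \<mu> \<noteq> {0}"
proof (rule ccontr)
  assume "\<not> thesis"
  then have "(\<Union>\<mu>\<in>dual h. weight_space h V \<mu>) \<subseteq> {0}"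
    using that by blast
  then have "M.span (\<Union>\<mu>\<in>dual h. weight_space h V \<mu>) \<subseteq> {0}"
    by (rule M.span_minimal) simp
  moreover have "M.span (\<Union>\<mu>\<in>dual h. weight_space h V \<mu>) = V"
    using obar_object_submodule[OF assms(1)] unfolding obar_object_def M.direct_sum_def by blast
  moreover have "0 \<in> V"
    using assms(1) M.subspace_0 unfolding submodule_def by blast
  ultimately show False
    using assms(2) by blast
qed

lemma weight_space_zero_if_components_zero:
  assumes "submodule A" "submodule B" "M.complementary A B N"
    and "weight_space h A \<mu> = {0}" "weight_space h B \<mu> = {0}"
  shows "weight_space h N \<mu> \<subseteq> {0}"
proof
  fix v assume v: "v \<in> weight_space h N \<mu>"
  obtain x y where xy: "x \<in> A" "y \<in> B" "v = x + y"
    using M.complementary_decompose[OF assms(3), of v] v unfolding weight_space_def by auto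
  have "x + y \<in> weight_space h UNIV \<mu>"
    using v unfolding xy(3) weight_space_def by auto
  from weight_vector_components[OF assms(1-3) xy(1,2) this] have "x = 0" "y = 0"
    using assms(4,5) by auto
  then show "v \<in> {0}"
    using xy(3) by simp
qed

text \<open>The summand is minimal among those inside \<open>C\<close> that have a given weight \<open>\<mu>\<close> of \<open>C\<close>.  Its complement is
  tracked along with it and grows from \<open>E\<close>, which makes chains have bounds by
  \<open>summand_pair_chain\<close> and ensures \<open>E \<subseteq> D\<close>.\<close>

lemma indecomposable_summand:
  assumes "summand_pair C E" "C \<noteq> {0}"
  obtains N D where "summand_pair N D" "N \<subseteq> C" "E \<subseteq> D" "obar_indecomposable h b N"
proof -
  obtain \<mu> where \<mu>: "\<mu> \<in> dual h" "weight_space h C \<mu> \<noteq> {0}"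
    using nonzero_weight_space assms unfolding summand_pair_def by blast
  define A where "A = {(N, D). summand_pair N D \<and> N \<subseteq> C \<and> E \<subseteq> D \<and> weight_space h N \<mu> \<noteq> {0}}"
  define le where "le p q \<longleftrightarrow> fst q \<subseteq> fst p \<and> snd p \<subseteq> snd q" for p q :: "'m set \<times> 'm set"
  have CE: "(C, E) \<in> A"
    using assms \<mu> unfolding A_def by auto
  have "\<exists>m\<in>A. \<forall>a\<in>A. le m a \<longrightarrow> a = m"
  proof (rule predicate_Zorn)
    show "partial_order_on A (relation_of le A)"
      by (rule partial_order_on_relation_ofI) (auto simp: le_def prod_eq_iff)
    fix K assume K: "K \<in> Chains (relation_of le A)"
    then have KA: "\<And>p. p \<in> K \<Longrightarrow> p \<in> A" and lin: "\<And>p q. p \<in> K \<Longrightarrow> q \<in> K \<Longrightarrow> le p q \<or> le q p"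
      unfolding Chains_def relation_of_def by auto
    show "\<exists>u\<in>A. \<forall>a\<in>K. le a u"
    proof (cases "K = {}")
      case True
      then show ?thesis
        using CE by blast
    next
      case False
      let ?N = "\<Inter>p\<in>K. fst p" and ?D = "\<Union>p\<in>K. snd p"
      have K: "summand_pair (fst p) (snd p)" "fst p \<subseteq> C" "E \<subseteq> snd p"
        "weight_space h (fst p) \<mu> \<noteq> {0}" if "p \<in> K" for p
        using KA[OF that] unfolding A_def by auto
      have "summand_pair ?N ?D"
        by (rule summand_pair_chain) (use K lin False in \<open>auto simp: le_def\<close>)
      moreover obtain p where "p \<in> K" "weight_space h (fst p) \<mu> = weight_space h ?N \<mu>"
      proof (rule chain_weight_space_stabilizes[of K fst \<mu>])
        show "fst p \<subseteq> fst q \<or> fst q \<subseteq> fst p" if "p \<in> K" "q \<in> K" for p q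
          using lin[OF that] unfolding le_def by blast
      qed (use K(1) False \<mu>(1) in \<open>auto simp: summand_pair_def\<close>)
      moreover have "?N \<subseteq> C" "E \<subseteq> ?D"
        using K(2,3) False by blast+
      ultimately have "(?N, ?D) \<in> A"
        using K(4)[of p] unfolding A_def by simp
      then show ?thesis
        unfolding le_def by (intro bexI[of _ "(?N, ?D)"]) auto
    qed
  qed
  then obtain N D where ND: "(N, D) \<in> A" and max: "\<And>N' D'. (N', D') \<in> A \<Longrightarrow> N' \<subseteq> N \<Longrightarrow> D \<subseteq> D' \<Longrightarrow> N' = N"
    unfolding le_def by (metis fst_conv prod.collapse snd_conv)
  have N: "submodule N" "submodule D" "M.complementary N D UNIV" "summand_pair N D"
    "N \<subseteq> C" "E \<subseteq> D" "weight_space h N \<mu> \<noteq> {0}"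
    using ND unfolding A_def summand_pair_def by auto
  \<comment> \<open>In a splitting of the minimal \<open>N\<close>, a part that has the weight \<open>\<mu>\<close> is all of \<open>N\<close>.\<close>
  have zero: "V2 = {0}"
    if V: "submodule V1" "submodule V2" "M.complementary V1 V2 N" "weight_space h V1 \<mu> \<noteq> {0}" for V1 V2
  proof -
    have sub: "V1 \<subseteq> N" "V2 \<subseteq> N" "V1 \<inter> V2 = {0}"
      using V(3) M.span_superset[of "V1 \<union> V2"] unfolding M.complementary_def by auto
    have "summand_pair V1 (M.span (V2 \<union> D))"
      unfolding summand_pair_def
      using V(1,2) N(2) M.complementary_regroup[OF N(3) V(3)] submodule_span_Un by blast
    moreover have "D \<subseteq> M.span (V2 \<union> D)"
      using M.span_superset[of "V2 \<union> D"] by blast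
    ultimately have "V1 = N"
      using max[of V1 "M.span (V2 \<union> D)"] sub(1) N(5,6) V(4) unfolding A_def by blast
    then show ?thesis
      using sub by blast
  qed
  have "V1 = {0} \<or> V2 = {0}"
    if V: "obar_object h b V1" "obar_object h b V2" "M.complementary V1 V2 N" for V1 V2
  proof -
    have subm: "submodule V1" "submodule V2"
      using V(1,2) unfolding obar_object_def by auto
    have "0 \<in> weight_space h N \<mu>"
      using N(1) M.subspace_0 subspace_weight_space unfolding submodule_def by blast
    then have "weight_space h V1 \<mu> \<noteq> {0} \<or> weight_space h V2 \<mu> \<noteq> {0}"
      using weight_space_zero_if_components_zero[OF subm V(3), of \<mu>] N(7) by blast
    moreover have V': "M.complementary V2 V1 N"
      by (rule M.complementary_commute[THEN iffD1, OF V(3)])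
    ultimately show ?thesis
      using zero[OF subm V(3)] zero[OF subm(2,1) V'] by blast
  qed
  moreover have "N \<noteq> {0}"
    using N(7) \<open>submodule N\<close> M.subspace_0 act_0 unfolding weight_space_def by auto
  ultimately have "obar_indecomposable h b N"
    unfolding obar_indecomposable_def using obar_object_submodule[OF N(1)] by blast
  then show ?thesis
    using that N(4-6) by blast
qed

section \<open>The decomposition\<close>

text \<open>Zorn's lemma for pairs \<open>(S, C)\<close> of an independent set of indecomposables and a complement of
  its sum.  In a chain of such pairs the sums increase and the complements decrease, so
  \<open>summand_pair_chain\<close> provides the complement for the union.\<close>

lemma direct_sum_of_indecomposables:
  "\<exists>\<N>. (\<forall>N\<in>\<N>. obar_indecomposable h b N) \<and> M.direct_sum \<N> (\<lambda>N. N) UNIV"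
proof -
  define A where "A = {(S, C). (\<forall>N\<in>S. obar_indecomposable h b N) \<and>
    M.direct_sum S (\<lambda>N. N) (M.span (\<Union>S)) \<and> summand_pair C (M.span (\<Union>S))}"
  define le where "le p q \<longleftrightarrow> fst p \<subseteq> fst q \<and> snd q \<subseteq> snd p" for p q :: "'m set set \<times> 'm set"
  have base: "({}, UNIV) \<in> A"
    unfolding A_def M.direct_sum_def summand_pair_def M.complementary_def submodule_def
    by (auto simp: act_0)
  have "\<exists>m\<in>A. \<forall>a\<in>A. le m a \<longrightarrow> a = m"
  proof (rule predicate_Zorn)
    show "partial_order_on A (relation_of le A)"
      by (rule partial_order_on_relation_ofI) (auto simp: le_def prod_eq_iff)
    fix K assume K: "K \<in> Chains (relation_of le A)"
    then have KA: "\<And>p. p \<in> K \<Longrightarrow> p \<in> A" and lin: "\<And>p q. p \<in> K \<Longrightarrow> q \<in> K \<Longrightarrow> le p q \<or> le q p"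
      unfolding Chains_def relation_of_def by auto
    show "\<exists>u\<in>A. \<forall>a\<in>K. le a u"
    proof (cases "K = {}")
      case True
      then show ?thesis
        using base by blast
    next
      case False
      let ?S = "\<Union>(fst ` K)" and ?C = "\<Inter>p\<in>K. snd p"
      let ?D = "\<lambda>p. M.span (\<Union>(fst p))"
      have K: "\<forall>N\<in>fst p. obar_indecomposable h b N" "M.direct_sum (fst p) (\<lambda>N. N) (?D p)"
        "summand_pair (snd p) (?D p)" if "p \<in> K" for p
        using KA[OF that] unfolding A_def by auto
      have le_D: "snd q \<subseteq> snd p \<and> ?D p \<subseteq> ?D q" if "le p q" for p q
        using that unfolding le_def by (auto intro!: M.span_mono)
      have pair: "summand_pair ?C (\<Union>p\<in>K. ?D p)"
        by (rule summand_pair_chain) (use K lin le_D False in blast)+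
      have "M.span (\<Union>?S) \<subseteq> (\<Union>p\<in>K. ?D p)"
      proof (rule M.span_minimal)
        show "\<Union>?S \<subseteq> (\<Union>p\<in>K. ?D p)"
          using M.span_superset by blast
        show "M.subspace (\<Union>p\<in>K. ?D p)"
          using pair unfolding summand_pair_def submodule_def by blast
      qed
      moreover have "?D p \<subseteq> M.span (\<Union>?S)" if "p \<in> K" for p
        using that by (intro M.span_mono) auto
      ultimately have "(\<Union>p\<in>K. ?D p) = M.span (\<Union>?S)"
        by blast
      moreover have "M.direct_sum ?S (\<lambda>N. N) (M.span (\<Union>?S))"
      proof (rule M.direct_sum_Union_chain)
        show "S \<subseteq> T \<or> T \<subseteq> S" if ST: "S \<in> fst ` K" "T \<in> fst ` K" for S T
        proof -
          obtain p q where "p \<in> K" "q \<in> K" "S = fst p" "T = fst q"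
            using ST by blast
          then show ?thesis
            using lin[of p q] unfolding le_def by blast
        qed
      qed (use K(2) False in auto)
      ultimately have "(?S, ?C) \<in> A"
        using pair K(1) unfolding A_def by auto
      then show ?thesis
        unfolding le_def by (intro bexI[of _ "(?S, ?C)"]) auto
    qed
  qed
  then obtain S C where SC: "(S, C) \<in> A" and max: "\<And>S' C'. (S', C') \<in> A \<Longrightarrow> S \<subseteq> S' \<Longrightarrow> C' \<subseteq> C \<Longrightarrow> C' = C"
    unfolding le_def by (metis fst_conv prod.collapse snd_conv)
  let ?E = "M.span (\<Union>S)"
  have S: "\<forall>N\<in>S. obar_indecomposable h b N" "M.direct_sum S (\<lambda>N. N) ?E" "summand_pair C ?E"
    using SC unfolding A_def by auto
  have "C = {0}"
  proof (rule ccontr)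
    assume "C \<noteq> {0}"
    then obtain N D where N: "summand_pair N D" "N \<subseteq> C" "?E \<subseteq> D" "obar_indecomposable h b N"
      using indecomposable_summand[OF S(3)] by blast
    have comp: "M.complementary C ?E UNIV" "M.complementary N D UNIV"
      and subm: "submodule C" "submodule N" "submodule D"
      using S(3) N(1) unfolding summand_pair_def by auto
    have span: "M.span (\<Union>(insert N S)) = M.span (N \<union> ?E)"
      by (simp add: M.span_Un M.span_span)
    have "N \<inter> ?E = {0}"
      using N(2) comp(1) subm(2) M.subspace_0 M.span_zero
      unfolding M.complementary_def submodule_def by blast
    then have "M.direct_sum (insert N S) (\<lambda>N. N) (M.span (\<Union>(insert N S)))"
      using M.direct_sum_insert[OF S(2)] subm(2) unfolding submodule_def by blast
    moreover have "summand_pair (C \<inter> D) (M.span (\<Union>(insert N S)))"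
      unfolding summand_pair_def span
    proof (intro conjI)
      show "submodule (C \<inter> D)"
        using subm M.subspace_inter unfolding submodule_def by auto
      show "submodule (M.span (N \<union> ?E))"
        using S(3) subm(2) submodule_span_Un unfolding summand_pair_def by blast
      show "M.complementary (C \<inter> D) (M.span (N \<union> ?E)) UNIV"
        by (rule M.complementary_modular[OF comp N(2,3)])
    qed
    ultimately have "(insert N S, C \<inter> D) \<in> A"
      using S(1) N(4) unfolding A_def by auto
    then have "C \<inter> D = C"
      using max by blast
    then have "N \<subseteq> N \<inter> D"
      using N(2) by blast
    then have "N \<subseteq> {0}"
      using comp(2) unfolding M.complementary_def by blast
    moreover have "N \<noteq> {0}" "0 \<in> N"
      using N(4) subm(2) M.subspace_0 unfolding obar_indecomposable_def submodule_def by auto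
    ultimately show False
      by blast
  qed
  moreover have "M.span (C \<union> ?E) = UNIV"
    using S(3) unfolding summand_pair_def M.complementary_def by blast
  ultimately have "?E = UNIV"
    by (simp add: M.span_insert_0 M.span_span)
  then show ?thesis
    using S(1,2) by auto
qed

end

theorem theorem5p10:
  fixes scale :: "'k::{alg_closed_field, field_char_0} \<Rightarrow> 'g::ab_group_add \<Rightarrow> 'g"
    and bracket :: "'g \<Rightarrow> 'g \<Rightarrow> 'g"
    and scaleM :: "'k \<Rightarrow> 'm::ab_group_add \<Rightarrow> 'm"
    and act :: "'g \<Rightarrow> 'm \<Rightarrow> 'm"
    and G :: "nat \<Rightarrow> 'g set"
    and h b :: "'g set"
  assumes "lie_algebra scale bracket"
    and "lie_algebra.root_reductive_exhaustion scale bracket G"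
    and "lie_algebra.splitting_maximal_toral scale bracket h"
    and "lie_algebra.splitting_borel scale bracket b"
    and "h \<subseteq> b"
    and "\<And>n. lie_algebra.maximal_toral_subalgebra scale bracket (h \<inter> G n) (G n)"
    and "\<And>n. lie_algebra.borel_subalgebra scale bracket (b \<inter> G n) (G n)"
    and "lie_module scale bracket scaleM act"
    and "lie_module.obar_object scale bracket scaleM act h b UNIV"
  shows "\<exists>\<N> :: 'm set set.
    (\<forall>N\<in>\<N>. lie_module.obar_indecomposable scale bracket scaleM act h b N) \<and>
    vector_space.direct_sum scaleM \<N> (\<lambda>N. N) UNIV"
proof -
  interpret lie_module scale bracket scaleM act
    by (rule assms(8))
  interpret obar_module scale bracket scaleM act h b
    by unfold_locales (rule assms(9))
  show ?thesis
    by (rule direct_sum_of_indecomposables)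
qed

end
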